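(* Let $N=\{(z,w)\in\mathbb{D}^2: z^2=w^3\}$. (1) For every $f\in\mathcal{O}(N,\mathbb{D})$ with $f(0,0)=0$ there exists $F\in\mathcal{O}(\mathbb{D}^2,\sqrt{2}\,\mathbb{D})$ with $F|_N=f$. (2) For every $f\in\mathcal{O}(N,\mathbb{D})$ with $f(0,0)\neq 0$ there exists $F\in\mathcal{O}(\mathbb{D}^2,(2\sqrt{2}+1)\mathbb{D})$ with $F|_N=f$. (3) There exists a function $f\in\mathcal{O}(N,\mathbb{D})$ such that for every $r<5/4$ there is no $F\in\mathcal{O}(\mathbb{D}^2,r\mathbb{D})$ with $F|_N=f$.
   Context: $\mathbb{D}$ is the open unit disk in $\mathbb{C}$ and $r\mathbb{D}$ is the disk of radius $r$ centered at $0$. A function $f:N\to\mathbb{C}$ is holomorphic if for each $x\in N$ there is a holomorphic function $F$ on a neighborhood $U$ of $x$ in $\mathbb{D}^2$ with $F=f$ on $U\cap N$. $\mathcal{O}(X,Y)$ denotes the set of holomorphic maps from $X$ to $Y$. *)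

theory Defs imports "HOL-Complex_Analysis.Complex_Analysis" begin

definition bidisk :: "(complex \<times> complex) set" where
  "bidisk = ball 0 1 \<times> ball 0 1"

definition cusp :: "(complex \<times> complex) set" where
  "cusp = {(z, w) \<in> bidisk. z ^ 2 = w ^ 3}"

text \<open>Holomorphy in two variables as Frechet differentiability with a complex-linear derivative
  at every point. The derivative is taken in the full space, so this is meant for open sets only.\<close>

definition holomorphic2_on :: "(complex \<times> complex \<Rightarrow> complex) \<Rightarrow> (complex \<times> complex) set \<Rightarrow> bool"
    (infixl "holomorphic2'_on" 50) where
  "F holomorphic2_on U \<longleftrightarrow>
     (\<forall>p\<in>U. \<exists>a b. (F has_derivative (\<lambda>(h, k). a * h + b * k)) (at p))"

text \<open>Holomorphy on a subset of the bidisk that need not be open: local extendability. Functions are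
  total, but only the values on the subset matter.\<close>

definition locally_extendable_on :: "(complex \<times> complex \<Rightarrow> complex) \<Rightarrow> (complex \<times> complex) set \<Rightarrow> bool" where
  "locally_extendable_on f X \<longleftrightarrow>
     (\<forall>x\<in>X. \<exists>U F. open U \<and> x \<in> U \<and> U \<subseteq> bidisk \<and> F holomorphic2_on U \<and> (\<forall>p\<in>U \<inter> X. F p = f p))"

definition hol_bidisk :: "complex set \<Rightarrow> (complex \<times> complex \<Rightarrow> complex) set" where
  "hol_bidisk Y = {F. F holomorphic2_on bidisk \<and> F ` bidisk \<subseteq> Y}"

definition hol_cusp :: "complex set \<Rightarrow> (complex \<times> complex \<Rightarrow> complex) set" where
  "hol_cusp Y = {f. locally_extendable_on f cusp \<and> f ` cusp \<subseteq> Y}"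

end

theory Submission imports Defs begin

text \<open>The cusp is the bijective image of the disk under \<open>l \<mapsto> (l\<^sup>3, l\<^sup>2)\<close>. Pulling back along
  this map turns a holomorphic function \<open>f\<close> on the cusp into a holomorphic function \<open>h\<close> on the
  disk with \<open>h'(0) = 0\<close>, because the coordinates \<open>l\<^sup>3\<close> and \<open>l\<^sup>2\<close> both have derivative \<open>0\<close> at the
  origin.

  Extension. Splitting the power series of \<open>h\<close> by parity gives
  \<open>h(l) = e(l\<^sup>2) + l\<^sup>3 o(l\<^sup>2)\<close>; the linear term, which could not be written in this way, is
  absent. Hence \<open>F(z, w) = e(w) + z o(w)\<close> extends \<open>f\<close>. For \<open>w = l\<^sup>2\<close> the numbers \<open>e(w)\<close> and
  \<open>l\<^sup>3 o(w)\<close> are half the sum and half the difference of \<open>h(l)\<close> and \<open>h(-l)\<close>, so by the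
  parallelogram law their squared moduli add up to at most \<open>1\<close>. By Cauchy-Schwarz,
  \<open>|F(z, w)| \<le> sqrt (1 + |z / l\<^sup>3|\<^sup>2)\<close>, which is below \<open>sqrt 2\<close> once \<open>|l|\<^sup>3 > |z|\<close>. For fixed \<open>z\<close>
  the maximum principle in \<open>w\<close> carries the bound from a circle close to the unit circle to all
  points inside (\<open>extension_from_cusp\<close>). Both positive assertions follow, since
  \<open>sqrt 2 < 2 sqrt 2 + 1\<close>.

  Lower bound. A holomorphic function on the bidisk that vanishes on the cusp has vanishing
  derivative at the origin, since the ideal generated by \<open>z\<^sup>2 - w\<^sup>3\<close> has no linear terms
  (\<open>derivative_vanishes_if_zero_on_cusp\<close>). So \<open>f\<close> determines the linear part \<open>a z + b w\<close> of every
  extension, and when \<open>f(0, 0) = 0\<close> the Schwarz lemma on the diagonal forces an extension into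
  \<open>r\<close> times the disk to have \<open>|a + b| \<le> r\<close> (\<open>linear_part_bound\<close>). If \<open>h(l) = l\<^sup>2 g(l)\<close>, then
  \<open>b = g(0)\<close> and \<open>a = g'(0)\<close>. For \<open>g\<close> from the disk to itself \<open>|g'(0)| \<le> 1 - |g(0)|\<^sup>2\<close>, and
  \<open>x + 1 - x\<^sup>2\<close> has maximum \<open>5/4\<close> at \<open>x = 1/2\<close>; the automorphism \<open>g(l) = (2 l + 1) / (2 + l)\<close>
  attains it.\<close>

section \<open>Holomorphic functions of two variables\<close>

lemma holomorphic2_on_fst: "fst holomorphic2_on U"
  unfolding holomorphic2_on_def
  by (intro ballI exI[of _ 1] exI[of _ 0])
     (auto intro!: derivative_eq_intros simp: case_prod_unfold)

lemma holomorphic2_on_compose_snd: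
  assumes "g holomorphic_on V" "open V" "snd ` U \<subseteq> V"
  shows "(\<lambda>p. g (snd p)) holomorphic2_on U"
  unfolding holomorphic2_on_def
proof
  fix p assume "p \<in> U"
  then have "(g has_field_derivative deriv g (snd p)) (at (snd p))"
    using assms by (intro holomorphic_derivI) auto
  then have "(g has_derivative (*) (deriv g (snd p))) (at (snd p))"
    by (simp add: has_field_derivative_def)
  then have "(g \<circ> snd has_derivative (*) (deriv g (snd p)) \<circ> snd) (at p)"
    by (intro diff_chain_at) (auto intro!: derivative_eq_intros)
  then show "\<exists>a b. ((\<lambda>p. g (snd p)) has_derivative (\<lambda>(h, k). a * h + b * k)) (at p)"
    by - (rule exI[of _ 0], rule exI[of _ "deriv g (snd p)"], simp add: o_def case_prod_unfold)
qed

lemma holomorphic2_on_add: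
  assumes "F holomorphic2_on U" "G holomorphic2_on U"
  shows "(\<lambda>p. F p + G p) holomorphic2_on U"
  unfolding holomorphic2_on_def
proof
  fix p assume "p \<in> U"
  then obtain a b c d where "(F has_derivative (\<lambda>(h, k). a * h + b * k)) (at p)"
    "(G has_derivative (\<lambda>(h, k). c * h + d * k)) (at p)"
    using assms unfolding holomorphic2_on_def by meson
  from has_derivative_add[OF this]
  show "\<exists>a b. ((\<lambda>p. F p + G p) has_derivative (\<lambda>(h, k). a * h + b * k)) (at p)"
    by - (rule exI[of _ "a + c"], rule exI[of _ "b + d"],
        simp add: case_prod_unfold algebra_simps)
qed

lemma holomorphic2_on_diff:
  assumes "F holomorphic2_on U" "G holomorphic2_on U"
  shows "(\<lambda>p. F p - G p) holomorphic2_on U"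
  unfolding holomorphic2_on_def
proof
  fix p assume "p \<in> U"
  then obtain a b c d where "(F has_derivative (\<lambda>(h, k). a * h + b * k)) (at p)"
    "(G has_derivative (\<lambda>(h, k). c * h + d * k)) (at p)"
    using assms unfolding holomorphic2_on_def by meson
  from has_derivative_diff[OF this]
  show "\<exists>a b. ((\<lambda>p. F p - G p) has_derivative (\<lambda>(h, k). a * h + b * k)) (at p)"
    by - (rule exI[of _ "a - c"], rule exI[of _ "b - d"],
        simp add: case_prod_unfold algebra_simps)
qed

lemma holomorphic2_on_mult:
  assumes "F holomorphic2_on U" "G holomorphic2_on U"
  shows "(\<lambda>p. F p * G p) holomorphic2_on U"
  unfolding holomorphic2_on_def
proof
  fix p assume "p \<in> U"
  then obtain a b c d where "(F has_derivative (\<lambda>(h, k). a * h + b * k)) (at p)"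
    "(G has_derivative (\<lambda>(h, k). c * h + d * k)) (at p)"
    using assms unfolding holomorphic2_on_def by meson
  from has_derivative_mult[OF this]
  show "\<exists>a b. ((\<lambda>p. F p * G p) has_derivative (\<lambda>(h, k). a * h + b * k)) (at p)"
    by - (rule exI[of _ "F p * c + a * G p"], rule exI[of _ "F p * d + b * G p"],
        simp add: case_prod_unfold algebra_simps)
qed

lemma holomorphic2_on_imp_continuous_on:
  assumes "F holomorphic2_on U"
  shows "continuous_on U F"
  using assms unfolding holomorphic2_on_def
  by (meson continuous_at_imp_continuous_on has_derivative_continuous)

lemma has_field_derivative_along_curve:
  assumes "(F has_derivative (\<lambda>(h, k). a * h + b * k)) (at (p t, q t))"
    and "(p has_field_derivative p') (at t)" "(q has_field_derivative q') (at t)"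
  shows "((\<lambda>t. F (p t, q t)) has_field_derivative a * p' + b * q') (at t)"
proof -
  have "((\<lambda>t. (p t, q t)) has_derivative (\<lambda>s. (p' * s, q' * s))) (at t)"
    using assms(2,3) by (intro has_derivative_Pair) (auto simp: has_field_derivative_def)
  from diff_chain_at[OF this assms(1)]
  have "((\<lambda>t. F (p t, q t)) has_derivative (\<lambda>(h, k). a * h + b * k) \<circ> (\<lambda>s. (p' * s, q' * s))) (at t)"
    by (simp add: o_def)
  moreover have "(\<lambda>(h, k). a * h + b * k) \<circ> (\<lambda>s. (p' * s, q' * s)) = (*) (a * p' + b * q')"
    by (auto simp: fun_eq_iff algebra_simps)
  ultimately show ?thesis
    by (simp add: has_field_derivative_def)
qed

lemma holomorphic_on_along_curve:
  assumes "F holomorphic2_on U" "open S" "p holomorphic_on S" "q holomorphic_on S"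
    and "\<And>t. t \<in> S \<Longrightarrow> (p t, q t) \<in> U"
  shows "(\<lambda>t. F (p t, q t)) holomorphic_on S"
  unfolding holomorphic_on_open[OF assms(2)]
proof
  fix t assume t: "t \<in> S"
  then obtain a b where "(F has_derivative (\<lambda>(h, k). a * h + b * k)) (at (p t, q t))"
    using assms unfolding holomorphic2_on_def by meson
  then show "\<exists>d. ((\<lambda>t. F (p t, q t)) has_field_derivative d) (at t)"
    using has_field_derivative_along_curve holomorphic_derivI[OF assms(3,2) t]
      holomorphic_derivI[OF assms(4,2) t] by blast
qed

section \<open>The normalization of the cusp\<close>

lemma cusp_subset_bidisk: "cusp \<subseteq> bidisk"
  by (auto simp: cusp_def)

lemma open_bidisk: "open bidisk"
  by (simp add: bidisk_def open_Times)

lemma mem_bidisk: "(z, w) \<in> bidisk \<longleftrightarrow> norm z < 1 \<and> norm w < 1"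
  by (simp add: bidisk_def)

lemma cusp_param_in_cusp:
  assumes "norm l < 1"
  shows "(l ^ 3, l ^ 2) \<in> cusp"
  using assms
  by (auto simp: cusp_def mem_bidisk norm_power power_less_one_iff simp flip: power_mult)

text \<open>Away from the origin the parameter is \<open>z / w\<close>.\<close>

lemma cusp_param_surj:
  assumes "(z, w) \<in> cusp"
  obtains l where "norm l < 1" "z = l ^ 3" "w = l ^ 2"
proof (cases "w = 0")
  case True
  then show ?thesis using assms that[of 0] by (simp add: cusp_def)
next
  case False
  have zw: "z ^ 2 = w ^ 3" "norm w < 1" using assms by (auto simp: cusp_def mem_bidisk)
  have w: "w = (z / w) ^ 2"
    using False zw by (simp add: power_divide field_simps power2_eq_square power3_eq_cube)
  have "z = (z / w) ^ 3"
    using False zw by (simp add: power_divide field_simps power2_eq_square power3_eq_cube)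
  moreover have "norm (z / w) < 1"
  proof -
    have "norm (z / w) ^ 2 < 1" using zw(2) w by (metis norm_power)
    then show ?thesis by (simp add: power_less_one_iff abs_square_less_1)
  qed
  ultimately show ?thesis using w that by blast
qed

text \<open>Near each point \<open>f\<close> agrees on the cusp with a function of two variables, to which the chain
  rule applies; both components of the parametrization have derivative \<open>0\<close> at the origin.\<close>

lemma pullback_to_normalization:
  assumes "locally_extendable_on f cusp"
  shows "(\<lambda>l. f (l ^ 3, l ^ 2)) holomorphic_on ball 0 1"
    and "deriv (\<lambda>l. f (l ^ 3, l ^ 2)) 0 = 0"
proof -
  let ?h = "\<lambda>l. f (l ^ 3, l ^ 2)"
  have D: "\<exists>a b. (?h has_field_derivative a * (3 * l ^ 2) + b * (2 * l)) (at l)"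
    if l: "norm l < 1" for l
  proof -
    have "(l ^ 3, l ^ 2) \<in> cusp" using l by (rule cusp_param_in_cusp)
    then obtain U F where UF: "open U" "(l ^ 3, l ^ 2) \<in> U" "F holomorphic2_on U"
      "\<forall>p\<in>U \<inter> cusp. F p = f p"
      using assms unfolding locally_extendable_on_def by blast
    then obtain a b where ab: "(F has_derivative (\<lambda>(h, k). a * h + b * k)) (at (l ^ 3, l ^ 2))"
      unfolding holomorphic2_on_def by blast
    have dF: "((\<lambda>l. F (l ^ 3, l ^ 2)) has_field_derivative a * (3 * l ^ 2) + b * (2 * l)) (at l)"
      using ab
      by (intro has_field_derivative_along_curve[where p = "\<lambda>l. l ^ 3" and q = "\<lambda>l. l ^ 2"])
         (auto intro!: derivative_eq_intros)
    have "open ((\<lambda>l. (l ^ 3, l ^ 2)) -` U \<inter> ball 0 1)"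
      using UF(1) by (intro open_Int open_vimage) (auto intro!: continuous_intros)
    moreover have "F (m ^ 3, m ^ 2) = ?h m" if "m \<in> (\<lambda>l. (l ^ 3, l ^ 2)) -` U \<inter> ball 0 1" for m
      using that UF(4) cusp_param_in_cusp[of m] by auto
    ultimately have "(?h has_field_derivative a * (3 * l ^ 2) + b * (2 * l)) (at l)"
      using UF(2) l by (intro has_field_derivative_transform_within_open[OF dF]) auto
    then show ?thesis by blast
  qed
  show "?h holomorphic_on ball 0 1"
    unfolding holomorphic_on_open[OF open_ball]
  proof
    fix l :: complex assume "l \<in> ball 0 1"
    then show "\<exists>d. (?h has_field_derivative d) (at l)" using D[of l] by auto
  qed
  show "deriv ?h 0 = 0"
    using D[of 0] DERIV_imp_deriv by fastforce
qed

section \<open>The extension\<close>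

text \<open>Even powers of \<open>l\<close> are powers of \<open>l\<^sup>2\<close>, and odd powers other than \<open>l\<close> itself are \<open>l\<^sup>3\<close> times a
  power of \<open>l\<^sup>2\<close>. The series of the even and of the odd part of \<open>h\<close> converge, and since every
  point of the disk is a square of such a point, so do both power series in \<open>l\<^sup>2\<close> on the disk.\<close>

lemma even_and_cubic_odd_part:
  assumes h: "h holomorphic_on ball 0 1" and d: "deriv h 0 = 0"
  obtains e o' where "e holomorphic_on ball 0 1" "o' holomorphic_on ball 0 1"
    "\<And>l. norm l < 1 \<Longrightarrow> e (l ^ 2) = (h l + h (- l)) / 2"
    "\<And>l. norm l < 1 \<Longrightarrow> l ^ 3 * o' (l ^ 2) = (h l - h (- l)) / 2"
proof -
  define a where "a n = (deriv ^^ n) h 0 / fact n" for n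
  have a1: "a 1 = 0" using d by (simp add: a_def)
  have S: "(\<lambda>n. a n * l ^ n) sums h l" if "norm l < 1" for l
    using holomorphic_power_series[OF h, of l] that by (simp add: a_def)
  have E: "(\<lambda>n. a (2 * n) * (l ^ 2) ^ n) sums ((h l + h (- l)) / 2)" if l: "norm l < 1" for l
  proof -
    have ze: "(a n * l ^ n + a n * (- l) ^ n) / 2 = 0" if "n \<notin> range (\<lambda>n. 2 * n)" for n
    proof -
      have "odd n" using that by (auto elim: evenE)
      then show ?thesis by simp
    qed
    have "(\<lambda>n. (a n * l ^ n + a n * (- l) ^ n) / 2) sums ((h l + h (- l)) / 2)"
      using S[of l] S[of "- l"] l by (intro sums_divide sums_add) auto
    then have "(\<lambda>n. (a (2 * n) * l ^ (2 * n) + a (2 * n) * (- l) ^ (2 * n)) / 2)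
        sums ((h l + h (- l)) / 2)"
      by (subst sums_mono_reindex[of "\<lambda>n. 2 * n"]) (auto simp: strict_mono_def ze)
    then show ?thesis by (simp add: power_mult)
  qed
  have O: "(\<lambda>n. a (2 * n + 3) * (l ^ 2) ^ n * l ^ 3) sums ((h l - h (- l)) / 2)"
    if l: "norm l < 1" for l
  proof -
    have ze: "(a n * l ^ n - a n * (- l) ^ n) / 2 = 0" if "n \<notin> range (\<lambda>n. 2 * n + 3)" for n
    proof (cases "even n")
      case False
      then obtain k where k: "n = 2 * k + 1" by (elim oddE)
      then have "k = 0"
        using that by (cases k) (auto simp: image_iff)
      then show ?thesis using k a1 by simp
    qed auto
    have "(\<lambda>n. (a n * l ^ n - a n * (- l) ^ n) / 2) sums ((h l - h (- l)) / 2)"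
      using S[of l] S[of "- l"] l by (intro sums_divide sums_diff) auto
    then have "(\<lambda>n. (a (2 * n + 3) * l ^ (2 * n + 3) - a (2 * n + 3) * (- l) ^ (2 * n + 3)) / 2)
        sums ((h l - h (- l)) / 2)"
      by (subst sums_mono_reindex[of "\<lambda>n. 2 * n + 3"]) (auto simp: strict_mono_def ze)
    then show ?thesis by (simp add: power_mult power_add mult.assoc) (simp add: mult_ac)
  qed
  have root: "norm (csqrt w) < 1" if "norm w < 1" for w
    using that by simp
  define e where "e w = (\<Sum>n. a (2 * n) * w ^ n)" for w
  define o' where "o' w = (\<Sum>n. a (2 * n + 3) * w ^ n)" for w
  have e: "(\<lambda>n. a (2 * n) * w ^ n) sums e w" if "norm w < 1" for w
    using E[OF root[OF that]] by (simp add: e_def sums_iff)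
  have o: "(\<lambda>n. a (2 * n + 3) * w ^ n) sums o' w" if "norm w < 1" for w
  proof (cases "w = 0")
    case True
    then show ?thesis using powser_sums_zero[of "\<lambda>n. a (2 * n + 3)"]
      by (simp add: o'_def sums_iff)
  next
    case False
    have "summable (\<lambda>n. a (2 * n + 3) * w ^ n * csqrt w ^ 3)"
      using O[OF root[OF that]] by (simp add: sums_iff)
    from summable_divide[OF this, of "csqrt w ^ 3"]
    have "summable (\<lambda>n. a (2 * n + 3) * w ^ n)" using False by simp
    then show ?thesis by (simp add: o'_def summable_sums)
  qed
  show thesis
  proof
    show "e holomorphic_on ball 0 1" "o' holomorphic_on ball 0 1"
      using e o by (auto intro!: power_series_holomorphic[of 0 1])
    fix l :: complex assume l: "norm l < 1"
    then have l2: "norm (l ^ 2) < 1" by (simp add: norm_power power_less_one_iff)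
    show "e (l ^ 2) = (h l + h (- l)) / 2"
      using E[OF l] e[OF l2] sums_unique2 by blast
    have "(\<lambda>n. a (2 * n + 3) * (l ^ 2) ^ n * l ^ 3) sums (o' (l ^ 2) * l ^ 3)"
      using o[OF l2] by (rule sums_mult2)
    then show "l ^ 3 * o' (l ^ 2) = (h l - h (- l)) / 2"
      using O[OF l] sums_unique2 by (metis mult.commute)
  qed
qed

text \<open>The parallelogram law followed by the Cauchy-Schwarz inequality for the vectors \<open>(1, s)\<close> and
  \<open>(|a + b| / 2, |a - b| / 2)\<close>.\<close>

lemma norm_even_odd_parts_le:
  fixes a b :: complex
  assumes "norm a \<le> 1" "norm b \<le> 1"
  shows "norm ((a + b) / 2) + s * norm ((a - b) / 2) \<le> sqrt (1 + s\<^sup>2)"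
proof (rule real_le_rsqrt)
  let ?A = "norm ((a + b) / 2)" and ?B = "norm ((a - b) / 2)"
  have "?A\<^sup>2 + ?B\<^sup>2 = ((norm a)\<^sup>2 + (norm b)\<^sup>2) / 2"
    by (simp add: norm_divide power_divide cmod_power2 field_simps) (simp add: power2_eq_square algebra_simps)
  also have "\<dots> \<le> 1"
    using assms power_le_one[of "norm a" 2] power_le_one[of "norm b" 2] by simp
  finally have "(1 + s\<^sup>2) * (?A\<^sup>2 + ?B\<^sup>2) \<le> 1 + s\<^sup>2"
    by (intro mult_left_le) auto
  \<comment> \<open>Lagrange's identity, which contains the Cauchy-Schwarz inequality.\<close>
  moreover have "(?A + s * ?B)\<^sup>2 + (s * ?A - ?B)\<^sup>2 = (1 + s\<^sup>2) * (?A\<^sup>2 + ?B\<^sup>2)"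
    by (simp only: power2_eq_square) algebra
  moreover have "0 \<le> (s * ?A - ?B)\<^sup>2" by simp
  ultimately show "(?A + s * ?B)\<^sup>2 \<le> 1 + s\<^sup>2" by linarith
qed

text \<open>The bound is uniform on a circle for each fixed \<open>z\<close>, with a constant strictly below
  \<open>sqrt 2\<close>, so that the maximum principle yields a map into the open disk.\<close>

lemma extension_from_cusp:
  assumes f: "f \<in> hol_cusp (ball 0 1)"
  obtains F where "F \<in> hol_bidisk (ball 0 (sqrt 2))" "\<And>p. p \<in> cusp \<Longrightarrow> F p = f p"
proof -
  define h where "h l = f (l ^ 3, l ^ 2)" for l
  have "locally_extendable_on f cusp" using f by (simp add: hol_cusp_def)
  note pullback = pullback_to_normalization[OF this, folded h_def]
  obtain e o' where
    e: "e holomorphic_on ball 0 1" and o: "o' holomorphic_on ball 0 1"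
    and eh: "\<And>l. norm l < 1 \<Longrightarrow> e (l ^ 2) = (h l + h (- l)) / 2"
    and oh: "\<And>l. norm l < 1 \<Longrightarrow> l ^ 3 * o' (l ^ 2) = (h l - h (- l)) / 2"
    using even_and_cubic_odd_part[OF pullback] by blast
  have h1: "norm (h l) \<le> 1" if "norm l < 1" for l
    using f cusp_param_in_cusp[OF that] by (force simp: hol_cusp_def h_def)
  define F where "F p = e (snd p) + fst p * o' (snd p)" for p
  have hF: "F holomorphic2_on bidisk"
    unfolding F_def
    by (intro holomorphic2_on_add holomorphic2_on_mult holomorphic2_on_fst
        holomorphic2_on_compose_snd[OF e] holomorphic2_on_compose_snd[OF o])
       (auto simp: bidisk_def)
  have bound: "norm (F (z, w)) < sqrt 2" if zw: "norm z < 1" "norm w < 1" for z w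
  proof -
    \<comment> \<open>The circle \<open>|w| = \<sigma>\<^sup>2\<close> corresponds to \<open>|l| = \<sigma>\<close>; it must enclose \<open>w\<close> and make
      \<open>|z / l\<^sup>3|\<close> less than \<open>1\<close>.\<close>
    have "\<forall>\<^sub>F \<sigma> in at_left (1::real). norm z < \<sigma> ^ 3 \<and> norm w < \<sigma> ^ 2 \<and> 0 < \<sigma> \<and> \<sigma> < 1"
    proof (intro eventually_conj)
      show "\<forall>\<^sub>F \<sigma> in at_left (1::real). norm z < \<sigma> ^ 3"
        using zw by (intro order_tendstoD(1)[where y = 1] tendsto_eq_intros) auto
      show "\<forall>\<^sub>F \<sigma> in at_left (1::real). norm w < \<sigma> ^ 2"
        using zw by (intro order_tendstoD(1)[where y = 1] tendsto_eq_intros) auto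
      show "\<forall>\<^sub>F \<sigma> in at_left (1::real). 0 < \<sigma>"
        by (intro order_tendstoD(1)[where y = 1] tendsto_eq_intros) auto
      show "\<forall>\<^sub>F \<sigma> in at_left (1::real). \<sigma> < 1"
        by (simp add: eventually_at_filter)
    qed
    from eventually_happens'[OF trivial_limit_at_left_real this]
    obtain \<sigma> where \<sigma>: "norm z < \<sigma> ^ 3" "norm w < \<sigma> ^ 2" "0 < \<sigma>" "\<sigma> < 1"
      by blast
    define s where "s = norm z / \<sigma> ^ 3"
    have s: "0 \<le> s" "s < 1" using \<sigma> by (simp_all add: s_def)
    have "\<sigma> ^ 2 < 1" using \<sigma> by (simp add: power_less_one_iff)
    then have sub: "cball 0 (\<sigma> ^ 2) \<subseteq> ball (0 :: complex) 1" by auto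
    have Fz: "(\<lambda>w. F (z, w)) holomorphic_on cball 0 (\<sigma> ^ 2)"
      unfolding F_def fst_conv snd_conv
      using holomorphic_on_subset[OF e sub] holomorphic_on_subset[OF o sub]
      by (intro holomorphic_intros)
    have "norm (F (z, w)) \<le> sqrt (1 + s\<^sup>2)"
    proof (rule maximum_modulus_frontier[where S = "ball 0 (\<sigma> ^ 2)" and f = "\<lambda>w. F (z, w)"])
      show "(\<lambda>w. F (z, w)) holomorphic_on interior (ball 0 (\<sigma> ^ 2))"
        using holomorphic_on_subset[OF Fz ball_subset_cball] by (simp add: interior_open)
      show "continuous_on (closure (ball 0 (\<sigma> ^ 2))) (\<lambda>w. F (z, w))"
        using Fz \<sigma> by (simp add: holomorphic_on_imp_continuous_on)
      show "w \<in> ball 0 (\<sigma> ^ 2)" using \<sigma> by simp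
      fix v :: complex assume "v \<in> frontier (ball 0 (\<sigma> ^ 2))"
      then have v: "norm v = \<sigma> ^ 2" using \<sigma> by simp
      define l where "l = csqrt v"
      have l: "v = l ^ 2" "norm l = \<sigma>" using \<sigma> v by (simp_all add: l_def)
      then have "l \<noteq> 0" "norm l < 1" using \<sigma> by auto
      have "o' v = ((h l - h (- l)) / 2) / l ^ 3"
        using oh[OF \<open>norm l < 1\<close>] \<open>l \<noteq> 0\<close> l(1) by (simp add: field_simps)
      moreover have "e v = (h l + h (- l)) / 2"
        using eh[OF \<open>norm l < 1\<close>] l(1) by simp
      ultimately have "F (z, v) = (h l + h (- l)) / 2 + z / l ^ 3 * ((h l - h (- l)) / 2)"
        by (simp add: F_def mult.commute)
      then have "norm (F (z, v)) \<le> norm ((h l + h (- l)) / 2) + norm (z / l ^ 3 * ((h l - h (- l)) / 2))"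
        by (simp only: norm_triangle_ineq)
      also have "\<dots> = norm ((h l + h (- l)) / 2) + s * norm ((h l - h (- l)) / 2)"
        by (simp add: norm_mult norm_divide norm_power l(2) s_def)
      also have "\<dots> \<le> sqrt (1 + s\<^sup>2)"
        using \<open>norm l < 1\<close> by (intro norm_even_odd_parts_le h1) auto
      finally show "norm (F (z, v)) \<le> sqrt (1 + s\<^sup>2)" .
    qed auto
    also have "\<dots> < sqrt 2" using s by (simp add: power_less_one_iff)
    finally show ?thesis .
  qed
  have "F p = f p" if "p \<in> cusp" for p
  proof -
    obtain z w where p: "p = (z, w)" by force
    with that obtain l where l: "norm l < 1" "z = l ^ 3" "w = l ^ 2" using cusp_param_surj by metis
    have "F p = (h l + h (- l)) / 2 + (h l - h (- l)) / 2"
      unfolding eh[OF l(1), symmetric] oh[OF l(1), symmetric] by (simp add: F_def p l)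
    then show ?thesis by (simp add: p l h_def field_simps)
  qed
  moreover have "F ` bidisk \<subseteq> ball 0 (sqrt 2)"
    using bound by (auto simp: mem_bidisk)
  ultimately show ?thesis
    using that[of F] hF by (simp add: hol_bidisk_def)
qed

section \<open>The lower bound\<close>

text \<open>Differentiability at a single point does not control the odd part of \<open>G(z, w)\<close> in \<open>z\<close> along
  the cusp, where \<open>z\<close> is much smaller than \<open>w\<close>. This estimate replaces it by the odd part of
  \<open>G(z, 0)\<close>: the difference \<open>G(z, w) - G(z, 0)\<close> is uniformly small by uniform continuity, hence so
  is its \<open>z\<close>-derivative by Cauchy's inequality.\<close>

lemma odd_increment_bound:
  assumes G: "G holomorphic2_on bidisk" and "\<epsilon> > 0"
  obtains \<delta> where "\<delta> > 0" "\<delta> \<le> 1/2"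
    "\<And>z w. norm z \<le> 1/4 \<Longrightarrow> norm w < \<delta> \<Longrightarrow>
       norm ((G (z, w) - G (- z, w)) - (G (z, 0) - G (- z, 0))) \<le> \<epsilon> * norm z"
proof -
  have "uniformly_continuous_on (cball 0 (1/2) \<times> cball 0 (1/2)) G"
  proof (rule compact_uniformly_continuous)
    show "continuous_on (cball 0 (1/2) \<times> cball 0 (1/2)) G"
      using holomorphic2_on_imp_continuous_on[OF G]
      by (rule continuous_on_subset) (auto simp: bidisk_def)
  qed (simp add: compact_Times)
  from this[unfolded uniformly_continuous_on_def, rule_format, of "\<epsilon> / 8"] \<open>\<epsilon> > 0\<close>
  obtain d where d: "d > 0" "\<forall>p \<in> cball 0 (1/2) \<times> cball 0 (1/2). \<forall>q \<in> cball 0 (1/2) \<times> cball 0 (1/2).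
      dist q p < d \<longrightarrow> dist (G q) (G p) < \<epsilon> / 8"
    by auto
  show thesis
  proof
    show "min d (1/2) > 0" "min d (1/2) \<le> 1/2" using d by auto
    fix z w :: complex assume z: "norm z \<le> 1/4" and w: "norm w < min d (1/2)"
    define v where "v z = G (z, w) - G (z, 0)" for z
    \<comment> \<open>Cauchy's inequality on circles of radius \<open>1/4\<close> multiplies the bound by \<open>4\<close>, and the
      distance from \<open>z\<close> to \<open>-z\<close> is \<open>2 |z|\<close>; hence the eighth of \<open>\<epsilon>\<close>.\<close>
    have v_small: "norm (v x) \<le> \<epsilon> / 8" if "norm x \<le> 1/2" for x
      using d(2)[rule_format, of "(x, 0)" "(x, w)"] w that
      by (simp add: v_def dist_Pair_Pair dist_norm less_imp_le)
    have v: "v holomorphic_on ball 0 1"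
      unfolding v_def using w
      by (intro holomorphic_on_diff holomorphic_on_along_curve[OF G])
         (auto intro!: holomorphic_intros simp: mem_bidisk)
    have v': "norm (deriv v x) \<le> \<epsilon> / 2" if x: "norm x \<le> 1/4" for x
    proof -
      have sub: "cball x (1/4) \<subseteq> cball 0 (1/2)"
        using x by (simp add: cball_subset_cball_iff dist_norm)
      then have "cball x (1/4) \<subseteq> ball 0 1" by (auto simp: subset_eq)
      then have hx: "v holomorphic_on cball x (1/4)" using v holomorphic_on_subset by blast
      have "norm ((deriv ^^ 1) v x) \<le> fact 1 * (\<epsilon> / 8) / (1/4) ^ 1"
      proof (rule Cauchy_inequality)
        show "v holomorphic_on ball x (1/4)" using hx holomorphic_on_subset ball_subset_cball by blast
        show "continuous_on (cball x (1/4)) v" using hx by (rule holomorphic_on_imp_continuous_on)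
        show "norm (v y) \<le> \<epsilon> / 8" if "norm (x - y) = 1/4" for y
          using that sub by (intro v_small) (auto simp: subset_eq dist_norm)
      qed auto
      then show ?thesis by simp
    qed
    have "norm (v z - v (- z)) \<le> \<epsilon> / 2 * norm (z - (- z))"
    proof (rule field_differentiable_bound[where S = "cball 0 (1/4)" and f' = "deriv v"])
      show "(v has_field_derivative deriv v x) (at x within cball 0 (1/4))"
        if "x \<in> cball 0 (1/4)" for x
        using holomorphic_derivI[OF v open_ball] that
        by (simp add: has_field_derivative_at_within)
      show "norm (deriv v x) \<le> \<epsilon> / 2" if "x \<in> cball 0 (1/4)" for x
        using v' that by simp
    qed (use z in simp_all)
    also have "z - (- z) = 2 * z" by simp
    finally show "norm ((G (z, w) - G (- z, w)) - (G (z, 0) - G (- z, 0))) \<le> \<epsilon> * norm z"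
      by (simp add: v_def algebra_simps norm_mult)
  qed
qed

text \<open>The \<open>w\<close>-derivative is read off along \<open>z = w * csqrt w\<close>, which is tangent to the \<open>w\<close>-axis. For the
  \<open>z\<close>-derivative, the two points \<open>(\<plusminus>l\<^sup>3, l\<^sup>2)\<close> of the cusp lie on a horizontal line, and the
  difference quotient of \<open>G\<close> between them is \<open>0\<close>; as \<open>l\<close> tends to \<open>0\<close> it approaches the
  \<open>z\<close>-derivative at the origin by \<open>odd_increment_bound\<close>.\<close>

lemma derivative_vanishes_if_zero_on_cusp:
  assumes G: "G holomorphic2_on bidisk" and zero: "\<And>p. p \<in> cusp \<Longrightarrow> G p = 0"
    and D: "(G has_derivative (\<lambda>(h, k). a * h + b * k)) (at (0, 0))"
  shows "a = 0" "b = 0"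
proof -
  \<comment> \<open>The principal root is discontinuous on the negative axis but continuous at \<open>0\<close>, which is all
    that differentiability of \<open>w * csqrt w\<close> at \<open>0\<close> requires.\<close>
  have "((\<lambda>w. w * csqrt w) has_field_derivative 0) (at 0)"
    unfolding CARAT_DERIV
  proof (intro exI[of _ csqrt] conjI)
    have "(csqrt \<longlongrightarrow> 0) (at 0)"
      by (rule tendsto_norm_zero_cancel) (auto intro!: tendsto_eq_intros)
    then show "isCont csqrt 0" by (simp add: isCont_def)
  qed auto
  then have "((\<lambda>w. G (w * csqrt w, w)) has_field_derivative a * 0 + b * 1) (at 0)"
    using D by (intro has_field_derivative_along_curve) auto
  moreover have "((\<lambda>w. G (w * csqrt w, w)) has_field_derivative 0) (at 0)"
  proof (rule has_field_derivative_transform_within_open[where S = "ball 0 1" and f = "\<lambda>w. 0"])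
    fix w :: complex assume w: "w \<in> ball 0 1"
    have "csqrt w ^ 2 = w" "csqrt w ^ 3 = w * csqrt w"
      by (simp_all add: power3_eq_cube flip: power2_eq_square)
    then show "0 = G (w * csqrt w, w)"
      using zero cusp_param_in_cusp[of "csqrt w"] w by simp
  qed auto
  ultimately show "b = 0" using DERIV_unique by fastforce

  define u where "u z = G (z, 0) - G (- z, 0)" for z
  have "((\<lambda>z. G (z, 0)) has_field_derivative a * 1 + b * 0) (at 0)"
       "((\<lambda>z. G (- z, 0)) has_field_derivative a * (- 1) + b * 0) (at 0)"
    using D by (intro has_field_derivative_along_curve; auto intro!: derivative_eq_intros)+
  then have u': "(u has_field_derivative 2 * a) (at 0)"
    unfolding u_def by (auto intro!: derivative_eq_intros)
  have "norm (2 * a) \<le> \<epsilon>" if "\<epsilon> > 0" for \<epsilon>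
  proof -
    obtain \<delta> where \<delta>: "\<delta> > 0" "\<delta> \<le> 1/2" "\<And>z w. norm z \<le> 1/4 \<Longrightarrow> norm w < \<delta> \<Longrightarrow>
       norm ((G (z, w) - G (- z, w)) - u z) \<le> \<epsilon> * norm z"
      unfolding u_def using odd_increment_bound[OF G \<open>\<epsilon> > 0\<close>] by blast
    have "((\<lambda>z. (u z - u 0) / (z - 0)) \<longlongrightarrow> 2 * a) (at 0)"
      using u' unfolding has_field_derivative_iff by simp
    then have lim: "((\<lambda>z. norm (u z / z)) \<longlongrightarrow> norm (2 * a)) (at 0)"
      by (intro tendsto_norm) (simp add: u_def)
    have "filterlim (\<lambda>l::complex. l ^ 3) (at 0) (at 0)"
      unfolding filterlim_at by (auto intro!: tendsto_eq_intros simp: eventually_at_filter)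
    from filterlim_compose[OF lim this]
    have lim3: "((\<lambda>l. norm (u (l ^ 3) / l ^ 3)) \<longlongrightarrow> norm (2 * a)) (at 0)" .
    have "\<forall>\<^sub>F l in at 0. norm (u (l ^ 3) / l ^ 3) \<le> \<epsilon>"
      unfolding eventually_at
    proof (intro exI[of _ \<delta>] conjI ballI impI)
      fix l :: complex assume l: "l \<noteq> 0 \<and> dist l 0 < \<delta>"
      then have l1: "norm l < 1" and l2: "norm l ^ 2 \<le> \<delta> / 2" and l3: "norm l ^ 3 \<le> 1/4"
        using mult_mono[of "norm l" "1/2" "norm l" \<delta>] mult_mono[of "norm l * norm l" "1/4" "norm l" 1]
          mult_mono[of "norm l" "1/2" "norm l" "1/2"] \<delta>(1,2)
        by (auto simp: power2_eq_square power3_eq_cube)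
      have "G (l ^ 3, l ^ 2) = 0" "G (- (l ^ 3), l ^ 2) = 0"
        using zero cusp_param_in_cusp[of l] cusp_param_in_cusp[of "- l"] l1 by auto
      then have "norm (u (l ^ 3)) \<le> \<epsilon> * norm (l ^ 3)"
        using \<delta>(3)[of "l ^ 3" "l ^ 2"] l2 l3 \<delta>(1) by (simp add: norm_power)
      then show "norm (u (l ^ 3) / l ^ 3) \<le> \<epsilon>"
        using l by (simp add: norm_divide field_simps)
    qed (rule \<delta>)
    with lim3 show ?thesis by (rule tendsto_upperbound) simp
  qed
  then have "norm (2 * a) \<le> 0" by (meson dense_ge)
  then show "a = 0" by simp
qed

text \<open>The Schwarz lemma for the restriction of \<open>F\<close> to the diagonal, whose derivative at \<open>0\<close> is
  \<open>a + b\<close>.\<close>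

lemma linear_part_bound:
  assumes F: "F holomorphic2_on bidisk" "F ` bidisk \<subseteq> ball 0 r" "F (0, 0) = 0"
    and D: "(F has_derivative (\<lambda>(h, k). a * h + b * k)) (at (0, 0))"
  shows "norm (a + b) \<le> r"
proof -
  have bd: "norm (F (t, t)) < r" if "norm t < 1" for t
    using F(2) that by (force simp: mem_bidisk)
  have r: "r > 0" using bd[of 0] F(3) by simp
  let ?g = "\<lambda>t. F (t, t) / r"
  have "((\<lambda>t. F (t, t)) has_field_derivative a * 1 + b * 1) (at 0)"
    using D by (intro has_field_derivative_along_curve) auto
  then have "(?g has_field_derivative (a * 1 + b * 1) / r) (at 0)"
    by (rule DERIV_cdivide)
  then have d: "deriv ?g 0 = (a + b) / r" by (simp add: DERIV_imp_deriv)
  have "?g holomorphic_on ball 0 1"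
    using r by (intro holomorphic_intros holomorphic_on_along_curve[OF F(1)]) (auto simp: mem_bidisk)
  then have "norm (deriv ?g 0) \<le> 1"
    by (rule Schwarz_Lemma(2)[where \<xi> = 0]) (use r bd F(3) in \<open>auto simp: norm_divide\<close>)
  then show ?thesis using r d by (simp add: norm_divide)
qed

text \<open>On the cusp this is \<open>l\<^sup>2 (2 l + 1) / (2 + l)\<close>. Multiplying numerator and denominator by
  \<open>2 - l\<close> makes the denominator even in \<open>l\<close>, so that the quotient becomes a function of \<open>z = l\<^sup>3\<close>
  and \<open>w = l\<^sup>2\<close>.\<close>

definition extremal :: "complex \<times> complex \<Rightarrow> complex" where
  "extremal p = (2 * snd p - 2 * snd p ^ 2) / (4 - snd p) + fst p * (3 / (4 - snd p))"

lemma extremal_holomorphic: "extremal holomorphic2_on bidisk"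
proof -
  have "(\<lambda>w. (2 * w - 2 * w ^ 2) / (4 - w)) holomorphic_on ball 0 1"
    "(\<lambda>w::complex. 3 / (4 - w)) holomorphic_on ball 0 1"
    by (auto intro!: holomorphic_intros)
  from this[THEN holomorphic2_on_compose_snd, of bidisk] show ?thesis
    unfolding extremal_def
    by (intro holomorphic2_on_add holomorphic2_on_mult holomorphic2_on_fst) (auto simp: bidisk_def)
qed

lemma extremal_on_cusp:
  assumes l: "norm l < 1"
  shows "extremal (l ^ 3, l ^ 2) = l ^ 2 * ((2 * l + 1) / (2 + l))"
proof -
  have "2 + l \<noteq> 0" "2 - l \<noteq> 0"
    using l by (auto simp: add_eq_0_iff2 dest: arg_cong[of _ _ norm])
  moreover have "4 - l ^ 2 = (2 + l) * (2 - l)" by (simp add: algebra_simps power2_eq_square)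
  moreover have "(2 * l ^ 2 - 2 * (l ^ 2) ^ 2) / D + l ^ 3 * (3 / D) = (l ^ 2 * (2 * l + 1) * (2 - l)) / D" for D
    by (simp add: algebra_simps power2_eq_square power3_eq_cube flip: add_divide_distrib)
  ultimately show ?thesis
    unfolding extremal_def by simp
qed

lemma extremal_in_hol_cusp: "extremal \<in> hol_cusp (ball 0 1)"
proof -
  have "norm (extremal (l ^ 3, l ^ 2)) < 1" if l: "norm l < 1" for l
  proof -
    have "norm ((2 * l + 1) / (2 + l)) \<le> 1"
    proof -
      have "(norm (2 + l))\<^sup>2 - (norm (2 * l + 1))\<^sup>2 = 3 * (1 - (norm l)\<^sup>2)"
        by (simp add: cmod_power2) (simp add: power2_eq_square algebra_simps)
      also have "\<dots> \<ge> 0" using l power_le_one[of "norm l" 2] by simp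
      finally have "norm (2 * l + 1) \<le> norm (2 + l)" by (simp add: power2_le_iff_abs_le)
      then show ?thesis by (simp add: norm_divide divide_le_eq_1)
    qed
    moreover have "norm (l ^ 2) < 1" using l by (simp add: norm_power power_less_one_iff)
    ultimately show ?thesis
      unfolding extremal_on_cusp[OF l] norm_mult
      by (meson less_le_trans mult_left_le norm_ge_zero le_less_trans)
  qed
  then have "extremal ` cusp \<subseteq> ball 0 1"
    by (auto elim!: cusp_param_surj)
  moreover have "locally_extendable_on extremal cusp"
    unfolding locally_extendable_on_def
    using extremal_holomorphic open_bidisk cusp_subset_bidisk by blast
  ultimately show ?thesis by (simp add: hol_cusp_def)
qed

lemma extremal_has_derivative:
  "(extremal has_derivative (\<lambda>(h, k). 3/4 * h + 1/2 * k)) (at (0, 0))"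
  unfolding extremal_def
  by (auto intro!: derivative_eq_intros simp: case_prod_unfold fun_eq_iff)

lemma no_small_extension_of_extremal:
  assumes F: "F \<in> hol_bidisk (ball 0 r)" and ext: "\<And>p. p \<in> cusp \<Longrightarrow> F p = extremal p"
  shows "5/4 \<le> r"
proof -
  have hF: "F holomorphic2_on bidisk" and bF: "F ` bidisk \<subseteq> ball 0 r"
    using F by (auto simp: hol_bidisk_def)
  have "(0, 0) \<in> bidisk" "(0, 0) \<in> cusp" by (auto simp: mem_bidisk cusp_def)
  then have F0: "F (0, 0) = 0" using ext by (simp add: extremal_def)
  obtain a b where D: "(F has_derivative (\<lambda>(h, k). a * h + b * k)) (at (0, 0))"
    using hF \<open>(0, 0) \<in> bidisk\<close> unfolding holomorphic2_on_def by blast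
  have "((\<lambda>p. F p - extremal p) has_derivative (\<lambda>(h, k). (a - 3/4) * h + (b - 1/2) * k)) (at (0, 0))"
    using has_derivative_diff[OF D extremal_has_derivative]
    by (simp add: case_prod_unfold algebra_simps)
  moreover have "\<And>p. p \<in> cusp \<Longrightarrow> F p - extremal p = 0" using ext by simp
  ultimately have "a - 3/4 = 0" "b - 1/2 = 0"
    using derivative_vanishes_if_zero_on_cusp holomorphic2_on_diff[OF hF extremal_holomorphic]
    by blast+
  then have "a + b = 3/4 + 1/2" by (simp only: right_minus_eq)
  also have "\<dots> = 5/4" by simp
  finally have "norm (a + b) = norm (5/4 :: complex)" by (rule arg_cong)
  then show ?thesis using linear_part_bound[OF hF bF F0 D] by simp
qed

theorem theorem2p9:
  shows "(\<forall>f \<in> hol_cusp (ball 0 1). f (0, 0) = 0 \<longrightarrow>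
            (\<exists>F \<in> hol_bidisk (ball 0 (sqrt 2)). \<forall>p\<in>cusp. F p = f p))
       \<and> (\<forall>f \<in> hol_cusp (ball 0 1). f (0, 0) \<noteq> 0 \<longrightarrow>
            (\<exists>F \<in> hol_bidisk (ball 0 (2 * sqrt 2 + 1)). \<forall>p\<in>cusp. F p = f p))
       \<and> (\<exists>f \<in> hol_cusp (ball 0 1). \<forall>r::real. r < 5 / 4 \<longrightarrow>
            \<not> (\<exists>F \<in> hol_bidisk (ball 0 r). \<forall>p\<in>cusp. F p = f p))"
proof (intro conjI ballI impI)
  fix f assume "f \<in> hol_cusp (ball 0 1)"
  then obtain F where F: "F \<in> hol_bidisk (ball 0 (sqrt 2))" "\<forall>p\<in>cusp. F p = f p"
    using extension_from_cusp by metis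
  then show "\<exists>F \<in> hol_bidisk (ball 0 (sqrt 2)). \<forall>p\<in>cusp. F p = f p" by blast
  have "ball 0 (sqrt 2) \<subseteq> (ball 0 (2 * sqrt 2 + 1) :: complex set)"
    by (intro subset_ball) simp
  then have "F \<in> hol_bidisk (ball 0 (2 * sqrt 2 + 1))"
    using F(1) by (auto simp: hol_bidisk_def)
  then show "\<exists>F \<in> hol_bidisk (ball 0 (2 * sqrt 2 + 1)). \<forall>p\<in>cusp. F p = f p"
    using F(2) by blast
next
  show "\<exists>f \<in> hol_cusp (ball 0 1). \<forall>r::real. r < 5 / 4 \<longrightarrow>
          \<not> (\<exists>F \<in> hol_bidisk (ball 0 r). \<forall>p\<in>cusp. F p = f p)"
    using extremal_in_hol_cusp no_small_extension_of_extremal by (meson not_less)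
qed

end
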